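(* Let $A$ be a bigraded $K$-algebra satisfying conditions (i)--(iii) of the context, with fixed homogeneous generators $f_1,\ldots,f_m$ of $A_1$ and the corresponding presentation $\varphi:T=K[x_1,\ldots,x_n,y_1,\ldots,y_m]\to A$ with kernel $J$. Let $<'$ be a monomial order on $K[y_1,\ldots,y_m]$, $<_x$ a monomial order on $K[x_1,\ldots,x_n]$, and let $<$ be the product order on $T$ defined from them in the context. Suppose that $J$ satisfies the $x$-condition with respect to $<$. Let $k\ge1$, let $h_1^*<'\cdots<'h_s^*$ be all the monomials of degree $k$ in the variables $y_1,\ldots,y_m$ that do not belong to $\operatorname{in}_<(J)$, and let $h_j=\varphi(h_j^* )\in A_k$ for $j=1,\ldots,s$. Let $\mathcal G$ denote the reduced Gröbner basis of $J$ with respect to $<$. If $\mathcal G\subseteq(x_1,\ldots,x_n)T$, then $\{h_1,\ldots,h_s\}$ is a minimal generating set of the $S$-module $A_k$.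
   Context: Let $K$ be a field and $A=\bigoplus_{i,j}A_{(i,j)}$ a (commutative) bigraded $K$-algebra with $A_{(0,0)}=K$. Set $A_j=\bigoplus_iA_{(i,j)}$; then $A=\bigoplus_jA_j$ is a graded $A_0$-algebra, and each $A_j$ is a graded $A_0$-module with $(A_j)_i=A_{(i,j)}$. It is required that: (i) $A_0$ is the polynomial ring $S=K[x_1,\ldots,x_n]$ with the standard grading; (ii) $A_1$ is a finitely generated $S$-module and $(A_1)_i=0$ for $i<0$; (iii) $A=S[A_1]$, i.e. $A_i=A_1^i$ for all $i\ge1$. Fix homogeneous generators $f_1,\ldots,f_m$ of the $S$-module $A_1$ with $\deg f_i=d_i$. Let $T=K[x_1,\ldots,x_n,y_1,\ldots,y_m]$ be bigraded by $\deg x_i=(1,0)$, $\deg y_j=(d_j,1)$, and let $\varphi:T\to A$ be the surjective bigraded $K$-algebra homomorphism with $\varphi(x_i)=x_i$, $\varphi(y_j)=f_j$; $J=\operatorname{Ker}(\varphi)$. The product order $<$ on $T$ determined by $<'$ and $<_x$: for monomials $u,u'\in K[x_1,\ldots,x_n]$ and $w,w'\in K[y_1,\ldots,y_m]$, $uw<u'w'$ iff $w<'w'$, or $w=w'$ and $u<_xu'$. $J$ satisfies the $x$-condition with respect to a monomial order $<$ on $T$ if every minimal monomial generator of $\operatorname{in}_<(J)$ has the form $vw$ with $v\in S$ a monomial of degree $\le1$ and $w\in K[y_1,\ldots,y_m]$ a monomial. "Degree $k$ in the variables $y_1,\ldots,y_m$" means ordinary total degree, each $y_j$ counted with degree $1$.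 *)

theory Defs
  imports Complex_Main "HOL-Library.Poly_Mapping" "HOL-Library.Product_Plus"
begin

section \<open>Monomials and polynomials\<close>

text \<open>
  A monomial in finitely many variables indexed by a finite type \<open>'v\<close> is its exponent vector,
  written additively.  A monomial \<open>u w\<close> of \<open>T = K[x, y]\<close>, with \<open>u\<close> a monomial in the \<open>x\<close>
  and \<open>w\<close> a monomial in the \<open>y\<close>, is the pair \<open>(u, w)\<close>.  Polynomials are finitely supported
  functions from monomials to \<open>K\<close> with the convolution product, so that
  \<open>Poly_Mapping.single t 1\<close> is the monomial \<open>t\<close> regarded as a polynomial.
\<close>

type_synonym 'v monom = "'v \<Rightarrow>\<^sub>0 nat"
type_synonym ('x, 'k) polyS = "'x monom \<Rightarrow>\<^sub>0 'k"
type_synonym ('x, 'y, 'k) polyT = "('x monom \<times> 'y monom) \<Rightarrow>\<^sub>0 'k"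

definition mdeg :: "'v::finite monom \<Rightarrow> nat"
  where "mdeg t = (\<Sum>v\<in>UNIV. Poly_Mapping.lookup t v)"

definition homogeneous :: "int \<Rightarrow> ('x::finite, 'k::zero) polyS \<Rightarrow> bool"
  where "homogeneous i p \<longleftrightarrow> (\<forall>t\<in>Poly_Mapping.keys p. int (mdeg t) = i)"

definition mdvd :: "'m::comm_monoid_add \<Rightarrow> 'm \<Rightarrow> bool"
  where "mdvd s t \<longleftrightarrow> (\<exists>u. t = s + u)"

definition ideal_gen :: "'r::comm_ring_1 set \<Rightarrow> 'r set"
  where "ideal_gen B = module.span (*) B"

definition monom_eval :: "('v::finite \<Rightarrow> 'a::comm_monoid_mult) \<Rightarrow> 'v monom \<Rightarrow> 'a"
  where "monom_eval g t = (\<Prod>v\<in>UNIV. g v ^ Poly_Mapping.lookup t v)"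

definition evalS :: "('k::comm_ring_1 \<Rightarrow> 'a::comm_ring_1 \<Rightarrow> 'a) \<Rightarrow> ('x::finite \<Rightarrow> 'a) \<Rightarrow> ('x, 'k) polyS \<Rightarrow> 'a"
  where "evalS scale x p = (\<Sum>t\<in>Poly_Mapping.keys p. scale (Poly_Mapping.lookup p t) (monom_eval x t))"

text \<open>The homomorphism \<open>\<phi> : T \<rightarrow> A\<close> with \<open>x\<^sub>i \<mapsto> x i\<close> and \<open>y\<^sub>j \<mapsto> f j\<close>.\<close>

definition evalT :: "('k::comm_ring_1 \<Rightarrow> 'a::comm_ring_1 \<Rightarrow> 'a) \<Rightarrow> ('x::finite \<Rightarrow> 'a) \<Rightarrow> ('y::finite \<Rightarrow> 'a)
    \<Rightarrow> ('x, 'y, 'k) polyT \<Rightarrow> 'a"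
  where "evalT scale x f p =
    (\<Sum>t\<in>Poly_Mapping.keys p. scale (Poly_Mapping.lookup p t)
      (monom_eval x (fst t) * monom_eval f (snd t)))"

definition kernel :: "('r \<Rightarrow> 'a::zero) \<Rightarrow> 'r set"
  where "kernel h = {p. h p = 0}"


section \<open>Monomial orders and Groebner bases\<close>

text \<open>A monomial order is given by its strict part.\<close>

definition monomial_order :: "('m::comm_monoid_add \<Rightarrow> 'm \<Rightarrow> bool) \<Rightarrow> bool"
  where "monomial_order lt \<longleftrightarrow>
    (\<forall>u. \<not> lt u u) \<and>
    (\<forall>u v w. lt u v \<longrightarrow> lt v w \<longrightarrow> lt u w) \<and>
    (\<forall>u v. u \<noteq> v \<longrightarrow> lt u v \<or> lt v u) \<and>
    (\<forall>u. u \<noteq> 0 \<longrightarrow> lt 0 u) \<and>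
    (\<forall>u v w. lt u v \<longrightarrow> lt (u + w) (v + w))"

definition product_order ::
  "('y monom \<Rightarrow> 'y monom \<Rightarrow> bool) \<Rightarrow> ('x monom \<Rightarrow> 'x monom \<Rightarrow> bool)
    \<Rightarrow> 'x monom \<times> 'y monom \<Rightarrow> 'x monom \<times> 'y monom \<Rightarrow> bool"
  where "product_order lty ltx = (\<lambda>(u, w) (u', w'). lty w w' \<or> (w = w' \<and> ltx u u'))"

text \<open>The initial monomial; meaningful for nonzero polynomials only.\<close>

definition in_monom :: "('m \<Rightarrow> 'm \<Rightarrow> bool) \<Rightarrow> ('m \<Rightarrow>\<^sub>0 'k::zero) \<Rightarrow> 'm"
  where "in_monom lt p = (THE t. t \<in> Poly_Mapping.keys p \<and> (\<forall>s\<in>Poly_Mapping.keys p. s \<noteq> t \<longrightarrow> lt s t))"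

definition in_ideal ::
  "('m::comm_monoid_add \<Rightarrow> 'm \<Rightarrow> bool) \<Rightarrow> ('m \<Rightarrow>\<^sub>0 'k::comm_ring_1) set \<Rightarrow> ('m \<Rightarrow>\<^sub>0 'k) set"
  where "in_ideal lt J = ideal_gen {Poly_Mapping.single (in_monom lt p) 1 | p. p \<in> J \<and> p \<noteq> 0}"

text \<open>
  The minimal monomial generators of a monomial ideal: the monomials in the ideal that are minimal
  with respect to divisibility.
\<close>

definition min_monom_gens :: "('m::comm_monoid_add \<Rightarrow>\<^sub>0 'k::comm_ring_1) set \<Rightarrow> 'm set"
  where "min_monom_gens I = {t. Poly_Mapping.single t 1 \<in> I \<and>
    (\<forall>s. Poly_Mapping.single s 1 \<in> I \<longrightarrow> mdvd s t \<longrightarrow> s = t)}"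

definition x_condition ::
  "('x::finite monom \<times> 'y monom \<Rightarrow> 'x monom \<times> 'y monom \<Rightarrow> bool)
    \<Rightarrow> ('x, 'y, 'k::comm_ring_1) polyT set \<Rightarrow> bool"
  where "x_condition lt J \<longleftrightarrow> (\<forall>(u, w) \<in> min_monom_gens (in_ideal lt J). mdeg u \<le> 1)"

definition groebner_basis ::
  "('m::comm_monoid_add \<Rightarrow> 'm \<Rightarrow> bool) \<Rightarrow> ('m \<Rightarrow>\<^sub>0 'k::comm_ring_1) set \<Rightarrow> ('m \<Rightarrow>\<^sub>0 'k) set \<Rightarrow> bool"
  where "groebner_basis lt J G \<longleftrightarrow> finite G \<and> G \<subseteq> J \<and> 0 \<notin> G \<and>
    in_ideal lt J = ideal_gen {Poly_Mapping.single (in_monom lt g) 1 | g. g \<in> G}"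

definition reduced_groebner_basis ::
  "('m::comm_monoid_add \<Rightarrow> 'm \<Rightarrow> bool) \<Rightarrow> ('m \<Rightarrow>\<^sub>0 'k::comm_ring_1) set \<Rightarrow> ('m \<Rightarrow>\<^sub>0 'k) set \<Rightarrow> bool"
  where "reduced_groebner_basis lt J G \<longleftrightarrow> groebner_basis lt J G \<and>
    (\<forall>g\<in>G. Poly_Mapping.lookup g (in_monom lt g) = 1) \<and>
    (\<forall>g\<in>G. \<forall>g'\<in>G. g \<noteq> g' \<longrightarrow> (\<forall>t\<in>Poly_Mapping.keys g. \<not> mdvd (in_monom lt g') t))"

text \<open>The ideal \<open>(x\<^sub>1, \<dots>, x\<^sub>n)T\<close>.\<close>

definition x_ideal :: "('x, 'y, 'k::comm_ring_1) polyT set"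
  where "x_ideal = ideal_gen (range (\<lambda>v. Poly_Mapping.single (Poly_Mapping.single v 1, 0) 1))"


section \<open>The bigraded algebras\<close>

text \<open>
  A bigraded \<open>K\<close>-algebra: \<open>A i j\<close> is the component of bidegree \<open>(i, j)\<close>, and the whole type
  \<open>'a\<close> is the internal direct sum of these components.
\<close>

locale bigraded_algebra = vector_space scale
  for scale :: "'k::field \<Rightarrow> 'a::comm_ring_1 \<Rightarrow> 'a" +
  fixes A :: "int \<Rightarrow> int \<Rightarrow> 'a set"
  assumes scale_mult: "scale c a * b = scale c (a * b)"
    and subspace_component: "subspace (A i j)"
    and direct_sum: "\<exists>!c :: (int \<times> int) \<Rightarrow>\<^sub>0 'a.
          (\<forall>i j. Poly_Mapping.lookup c (i, j) \<in> A i j) \<and>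
          a = (\<Sum>q\<in>Poly_Mapping.keys c. Poly_Mapping.lookup c q)"
    and mult_component: "a \<in> A i j \<Longrightarrow> b \<in> A i' j' \<Longrightarrow> a * b \<in> A (i + i') (j + j')"
    and component_00: "A 0 0 = range (\<lambda>c. scale c 1)"
begin

text \<open>\<open>A\<^sub>j = \<Oplus>\<^sub>i A\<^sub>(\<^sub>i\<^sub>,\<^sub>j\<^sub>)\<close>.\<close>

definition y_component :: "int \<Rightarrow> 'a set"
  where "y_component j = span (\<Union>i. A i j)"

end

text \<open>
  The ring \<open>S = K[x\<^sub>1, \<dots>, x\<^sub>n]\<close> is identified with \<open>A\<^sub>0\<close> through \<open>evalS scale x\<close>; its action
  on \<open>A\<close> is multiplication after this identification.
\<close>

definition S_action :: "('k::field \<Rightarrow> 'a::comm_ring_1 \<Rightarrow> 'a) \<Rightarrow> ('x::finite \<Rightarrow> 'a) \<Rightarrow> ('x, 'k) polyS \<Rightarrow> 'a \<Rightarrow> 'a"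
  where "S_action scale x p a = evalS scale x p * a"

text \<open>
  \<open>S_polynomial\<close> and \<open>S_graded\<close> say that evaluation at \<open>x\<close> is an
  isomorphism of graded algebras from the standard graded polynomial ring onto \<open>A\<^sub>0\<close>, and
  \<open>generated\<close> says that the smallest subring of \<open>A\<close> containing \<open>A\<^sub>0\<close> and \<open>A\<^sub>1\<close> is \<open>A\<close>.
\<close>

locale standard_bigraded_algebra = bigraded_algebra scale A
  for scale :: "'k::field \<Rightarrow> 'a::comm_ring_1 \<Rightarrow> 'a" and A :: "int \<Rightarrow> int \<Rightarrow> 'a set" +
  fixes x :: "'x::finite \<Rightarrow> 'a"
  assumes S_polynomial: "inj (evalS scale x)"
    and S_graded: "A i 0 = evalS scale x ` {p. homogeneous i p}"
    and A1_finitely_generated: "\<exists>F. finite F \<and> module.span (S_action scale x) F = y_component 1"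
    and A1_nonneg: "i < 0 \<Longrightarrow> A i 1 = {0}"
    and generated: "(\<lambda>B. \<forall>a\<in>B. \<forall>b\<in>B. a - b \<in> B \<and> a * b \<in> B) hull (y_component 0 \<union> y_component 1) = UNIV"

text \<open>Minimality is with respect to inclusion.\<close>

definition minimal_generating_set ::
  "('r::comm_ring_1 \<Rightarrow> 'a::ab_group_add \<Rightarrow> 'a) \<Rightarrow> 'a set \<Rightarrow> 'a set \<Rightarrow> bool"
  where "minimal_generating_set act H M \<longleftrightarrow>
    module.span act H = M \<and> (\<forall>H'. H' \<subset> H \<longrightarrow> module.span act H' \<noteq> M)"


section \<open>The action of \<open>S\<close> makes \<open>A\<close> an \<open>S\<close>-module\<close>

lemma monom_eval_add: "monom_eval g (s + t) = monom_eval g s * monom_eval g t"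
  by (simp add: monom_eval_def lookup_add power_add prod.distrib)

lemma polynomial_induct [case_names single sum]:
  fixes p :: "'m \<Rightarrow>\<^sub>0 'k::comm_monoid_add"
  assumes single: "\<And>t c. P (Poly_Mapping.single t c)"
    and sum: "\<And>p q. P p \<Longrightarrow> P q \<Longrightarrow> P (p + q)"
  shows "P p"
proof (induction p rule: Poly_Mapping.update_induct)
  case const
  show ?case using single[of undefined 0] by simp
next
  case (update p t c)
  have "Poly_Mapping.update t c p = Poly_Mapping.single t c + p"
    using update.hyps
    by (intro poly_mapping_eqI)
      (auto simp: lookup_update lookup_add lookup_single when_def in_keys_iff)
  then show ?case using single sum update.IH by simp
qed

context bigraded_algebra
begin

lemma evalS_superset:
  assumes "finite I" "Poly_Mapping.keys p \<subseteq> I"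
  shows "evalS scale x p = (\<Sum>t\<in>I. scale (Poly_Mapping.lookup p t) (monom_eval x t))"
  unfolding evalS_def using assms
  by (intro sum.mono_neutral_left) (auto simp: in_keys_iff)

lemma evalS_add: "evalS scale x (p + q) = evalS scale x p + evalS scale x q"
proof -
  let ?I = "Poly_Mapping.keys p \<union> Poly_Mapping.keys q"
  have "Poly_Mapping.keys (p + q) \<subseteq> ?I" by (rule Poly_Mapping.keys_add)
  then show ?thesis
    by (simp add: evalS_superset[of ?I] lookup_add scale_left_distrib sum.distrib)
qed

lemma evalS_single: "evalS scale x (Poly_Mapping.single t c) = scale c (monom_eval x t)"
  by (cases "c = 0") (simp_all add: evalS_def)

lemma scale_mult_right: "a * scale c b = scale c (a * b)"
  using scale_mult[of c b a] by (simp add: mult.commute)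

lemma evalS_mult: "evalS scale x (p * q) = evalS scale x p * evalS scale x q"
proof (induction p rule: polynomial_induct)
  case (single t c)
  show ?case
  proof (induction q rule: polynomial_induct)
    case (single s e)
    then show ?case
      by (simp add: mult_single evalS_single monom_eval_add scale_mult scale_mult_right)
  next
    case (sum q1 q2)
    then show ?case by (simp add: evalS_add distrib_left)
  qed
next
  case (sum p1 p2)
  then show ?case by (simp add: evalS_add distrib_right)
qed

lemma evalS_one: "evalS scale x 1 = 1"
  using evalS_single[of x 0 1] by (simp add: monom_eval_def)

lemma module_S_action: "module (S_action scale x)"
  by unfold_locales
    (simp_all add: S_action_def evalS_add evalS_mult evalS_one algebra_simps)

end

end

theory Submission
  imports Defs
begin

text \<open>
  The point is that \<open>\<G> \<subseteq> (x\<^sub>1, \<dots>, x\<^sub>n)T\<close> forces \<open>J \<subseteq> (x\<^sub>1, \<dots>, x\<^sub>n)T\<close>, because a Groebner basis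
  of an ideal generates it (\<open>groebner_basis_generates\<close>). This rests on the division algorithm and
  hence on the well-foundedness of monomial orders, which comes from Dickson's lemma.

  Since \<open>J \<subseteq> (x\<^sub>1, \<dots>, x\<^sub>n)T\<close>, every monomial of every element of \<open>J\<close> is divisible by some \<open>x\<^sub>i\<close>.
  So no monomial in the \<open>y\<^sub>j\<close> alone lies in \<open>in(J)\<close>, and the \<open>h\<^sub>j\<^sup>*\<close> are all the monomials of
  degree \<open>k\<close> in the \<open>y\<^sub>j\<close>.

  Their images generate \<open>A\<^sub>k\<close>: as \<open>\<phi>\<close> is surjective, an element of \<open>A\<^sub>k\<close> is an \<open>S\<close>-combination of
  monomials in the \<open>f\<^sub>j\<close>, and comparing components in the direct sum leaves only those of degree
  \<open>k\<close> (\<open>span_monomials_eq_component\<close>).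

  They are distinct and none of them is redundant: a relation \<open>h\<^sub>j = \<Sum>\<^sub>i p\<^sub>i h\<^sub>i\<close> over indices
  \<open>i \<noteq> j\<close> gives the element \<open>h\<^sub>j\<^sup>* - \<Sum>\<^sub>i p\<^sub>i h\<^sub>i\<^sup>*\<close> of \<open>J\<close>, in which \<open>h\<^sub>j\<^sup>*\<close>, a monomial divisible
  by no variable \<open>x\<^sub>i\<close>, has coefficient \<open>1\<close> (\<open>monomial_not_in_span_of_others\<close>).
\<close>

section \<open>Dickson's lemma and well-foundedness of monomial orders\<close>

lemma nat_sequence_mono_subsequence:
  fixes g :: "nat \<Rightarrow> nat"
  shows "\<exists>r :: nat \<Rightarrow> nat. strict_mono r \<and> mono (g \<circ> r)"
proof -
  obtain r :: "nat \<Rightarrow> nat" where r: "strict_mono r" "monoseq (g \<circ> r)"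
    using seq_monosub[of g] by (auto simp: o_def)
  show ?thesis
  proof (cases "mono (g \<circ> r)")
    case True
    with r(1) show ?thesis by blast
  next
    case False
    with r(2) have dec: "decseq (g \<circ> r)" by (simp add: monoseq_iff)
    \<comment> \<open>A decreasing sequence of naturals is constant from where it attains its least value.\<close>
    define m where "m = (LEAST y. y \<in> range (g \<circ> r))"
    have "m \<in> range (g \<circ> r)" unfolding m_def by (rule LeastI) auto
    then obtain N where N: "m = (g \<circ> r) N" by blast
    have "(g \<circ> r) (N + n) = m" for n
    proof (rule antisym)
      show "(g \<circ> r) (N + n) \<le> m" unfolding N using dec by (rule decseqD) simp
      show "m \<le> (g \<circ> r) (N + n)" unfolding m_def by (rule Least_le) auto
    qed
    then have "mono (g \<circ> (\<lambda>n. r (N + n)))" by (simp add: mono_def)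
    moreover have "strict_mono (\<lambda>n. r (N + n))"
      using r(1) by (simp add: strict_mono_def)
    ultimately show ?thesis by blast
  qed
qed

text \<open>Subsequences are extracted for one coordinate after another; monotonicity survives thinning.\<close>

lemma monomial_sequence_mono_subsequence:
  fixes s :: "nat \<Rightarrow> 'v monom"
  assumes "finite V"
  shows "\<exists>r :: nat \<Rightarrow> nat. strict_mono r \<and> (\<forall>v\<in>V. mono (\<lambda>n. Poly_Mapping.lookup (s (r n)) v))"
  using assms
proof (induction V)
  case empty
  show ?case by (rule exI[of _ id]) (simp add: strict_mono_def)
next
  case (insert v V)
  then obtain r :: "nat \<Rightarrow> nat" where r: "strict_mono r" "\<forall>v\<in>V. mono (\<lambda>n. Poly_Mapping.lookup (s (r n)) v)"
    by blast
  obtain q :: "nat \<Rightarrow> nat" where q: "strict_mono q" "mono ((\<lambda>n. Poly_Mapping.lookup (s (r n)) v) \<circ> q)"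
    using nat_sequence_mono_subsequence by blast
  have "strict_mono (r \<circ> q)" using r(1) q(1) by (rule strict_mono_o)
  moreover have "mono (\<lambda>n. Poly_Mapping.lookup (s ((r \<circ> q) n)) v')" if "v' \<in> V" for v'
    using r(2) that strict_mono_mono[OF q(1)] by (auto simp: mono_def)
  moreover have "mono (\<lambda>n. Poly_Mapping.lookup (s ((r \<circ> q) n)) v)" using q(2) by (simp add: o_def)
  ultimately show ?case by blast
qed

lemma mdvd_iff_lookup_le:
  fixes s t :: "'v monom"
  shows "mdvd s t \<longleftrightarrow> (\<forall>v. Poly_Mapping.lookup s v \<le> Poly_Mapping.lookup t v)"
proof
  assume "\<forall>v. Poly_Mapping.lookup s v \<le> Poly_Mapping.lookup t v"
  then have "t = s + (t - s)"
    by (intro poly_mapping_eqI) (simp add: lookup_add lookup_minus)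
  then show "mdvd s t" unfolding mdvd_def by blast
qed (auto simp: mdvd_def lookup_add)

text \<open>
  Dickson's lemma, in the form that excludes infinite descent: an infinite sequence of monomials
  cannot avoid divisibility of a later member by an earlier one.
\<close>

lemma dickson:
  fixes s :: "nat \<Rightarrow> 'v::finite monom"
  shows "\<exists>i j. i < j \<and> mdvd (s i) (s j)"
proof -
  obtain r :: "nat \<Rightarrow> nat" where r: "strict_mono r" "\<forall>v\<in>UNIV. mono (\<lambda>n. Poly_Mapping.lookup (s (r n)) v)"
    using monomial_sequence_mono_subsequence[of UNIV s] by auto
  have "r 0 < r 1" using r(1) by (simp add: strict_mono_def)
  moreover have "mdvd (s (r 0)) (s (r 1))"
    unfolding mdvd_iff_lookup_le using r(2) by (simp add: mono_def)
  ultimately show ?thesis by blast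
qed

lemma monomial_orderD:
  assumes "monomial_order lt"
  shows "\<not> lt u u"
    and "lt u v \<Longrightarrow> lt v w \<Longrightarrow> lt u w"
    and "u \<noteq> v \<Longrightarrow> lt u v \<or> lt v u"
    and "u \<noteq> 0 \<Longrightarrow> lt 0 u"
    and "lt u v \<Longrightarrow> lt (u + w) (v + w)"
  using assms unfolding monomial_order_def by blast+

lemma monomial_order_mdvd_not_less:
  assumes lt: "monomial_order lt" and "mdvd s t"
  shows "\<not> lt t s"
proof
  assume less: "lt t s"
  obtain u where t: "t = s + u" using assms(2) by (auto simp: mdvd_def)
  show False
  proof (cases "u = 0")
    case True
    with less t monomial_orderD(1)[OF lt] show False by simp
  next
    case False
    with monomial_orderD(5)[OF lt monomial_orderD(4)[OF lt], of u s]
    have "lt s t" by (simp add: t add.commute)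
    with less monomial_orderD(1,2)[OF lt] show False by blast
  qed
qed

text \<open>
  In an infinite descending chain a later monomial would be a multiple of an earlier one, but a
  monomial order puts multiples above.
\<close>

lemma wfp_monomial_order:
  fixes lt :: "'v::finite monom \<Rightarrow> 'v monom \<Rightarrow> bool"
  assumes lt: "monomial_order lt"
  shows "wfp lt"
proof (rule ccontr)
  assume "\<not> wfp lt"
  then obtain s where s: "\<And>i. lt (s (Suc i)) (s i)"
    unfolding wfp_def wf_iff_no_infinite_down_chain by auto
  have "lt (s j) (s i)" if "i < j" for i j
    using that
  proof (induction j)
    case (Suc j)
    then show ?case using s[of j] monomial_orderD(2)[OF lt] by (metis less_SucE)
  qed simp
  moreover obtain i j where "i < j" "mdvd (s i) (s j)" using dickson by blast
  ultimately show False using monomial_order_mdvd_not_less[OF lt] by blast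
qed

lemma monomial_order_product_order:
  assumes "monomial_order lty" "monomial_order ltx"
  shows "monomial_order (product_order lty ltx)"
  unfolding monomial_order_def
proof (intro conjI allI impI)
  note y = monomial_orderD[OF assms(1)] and x = monomial_orderD[OF assms(2)]
  show "\<not> product_order lty ltx u u" for u
    using x(1) y(1) by (auto simp: product_order_def)
  show "product_order lty ltx u w"
    if "product_order lty ltx u v" "product_order lty ltx v w" for u v w
    using that x(2) y(2) by (fastforce simp: product_order_def)
  show "product_order lty ltx u v \<or> product_order lty ltx v u" if "u \<noteq> v" for u v
    using that x(3) y(3) by (fastforce simp: product_order_def)
  show "product_order lty ltx 0 u" if "u \<noteq> 0" for u
    using that x(4) y(4) by (fastforce simp: product_order_def zero_prod_def)
  show "product_order lty ltx (u + w) (v + w)" if "product_order lty ltx u v" for u v w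
    using that x(5) y(5) by (cases u; cases v; cases w) (auto simp: product_order_def)
qed

lemma wfp_product_order:
  assumes "wfp lty" "wfp ltx"
  shows "wfp (product_order lty ltx)"
proof -
  \<comment> \<open>The swap puts the \<open>y\<close>-part first, which is the part that \<open>product_order\<close> compares first.\<close>
  let ?R = "inv_image ({(a, b). lty a b} <*lex*> {(a, b). ltx a b}) prod.swap"
  have "wf ?R" using assms unfolding wfp_def by (intro wf_inv_image wf_lex_prod)
  moreover have "{(a, b). product_order lty ltx a b} = ?R"
    by (auto simp: product_order_def inv_image_def)
  ultimately show ?thesis unfolding wfp_def by simp
qed

section \<open>Groebner bases generate\<close>

lemma in_monom_greatest_key:
  assumes lt: "monomial_order lt" and "p \<noteq> 0"
  shows "in_monom lt p \<in> Poly_Mapping.keys p"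
    and "\<And>s. s \<in> Poly_Mapping.keys p \<Longrightarrow> s \<noteq> in_monom lt p \<Longrightarrow> lt s (in_monom lt p)"
proof -
  note o = monomial_orderD[OF lt]
  let ?P = "\<lambda>t. t \<in> Poly_Mapping.keys p \<and> (\<forall>s\<in>Poly_Mapping.keys p. s \<noteq> t \<longrightarrow> lt s t)"
  have "\<exists>m\<in>Poly_Mapping.keys p. \<forall>s\<in>Poly_Mapping.keys p. s \<noteq> m \<longrightarrow> \<not> lt m s"
  proof (rule Finite_Set.bex_max_element)
    show "asymp_on (Poly_Mapping.keys p) lt"
    proof (rule asymp_onI)
      fix u v assume "lt u v"
      then show "\<not> lt v u" using o(1)[of u] o(2)[of u v u] by blast
    qed
    show "transp_on (Poly_Mapping.keys p) lt"
      by (rule transp_onI) (rule o(2))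
    show "Poly_Mapping.keys p \<noteq> {}" using \<open>p \<noteq> 0\<close> by simp
  qed simp
  then obtain m where "m \<in> Poly_Mapping.keys p" "\<forall>s\<in>Poly_Mapping.keys p. s \<noteq> m \<longrightarrow> \<not> lt m s"
    by blast
  moreover have "s \<noteq> m \<Longrightarrow> lt s m \<or> lt m s" for s using o(3)[of s m] .
  ultimately have m: "?P m" by blast
  have "?P (in_monom lt p)"
    unfolding in_monom_def
  proof (rule theI[of ?P, OF m])
    fix t assume "?P t"
    with m have "t \<noteq> m \<Longrightarrow> lt t m \<and> lt m t" by auto
    then show "t = m" using o(1)[of t] o(2)[of t m t] by blast
  qed
  then show "in_monom lt p \<in> Poly_Mapping.keys p"
    and "s \<in> Poly_Mapping.keys p \<Longrightarrow> s \<noteq> in_monom lt p \<Longrightarrow> lt s (in_monom lt p)" for s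
    by blast+
qed

interpretation ring_module: module "(*) :: 'r::comm_ring_1 \<Rightarrow> 'r \<Rightarrow> 'r"
  by unfold_locales (simp_all add: algebra_simps)

text \<open>
  Multiplication by an arbitrary polynomial only adds exponents, so divisibility by one of the
  given monomials passes to every monomial of a combination.
\<close>

lemma keys_monomial_ideal:
  fixes p :: "'m::comm_monoid_add \<Rightarrow>\<^sub>0 'k::comm_ring_1"
  assumes "p \<in> ideal_gen ((\<lambda>s. Poly_Mapping.single s 1) ` M)" and "t \<in> Poly_Mapping.keys p"
  shows "\<exists>s\<in>M. mdvd s t"
proof -
  let ?D = "{p :: 'm \<Rightarrow>\<^sub>0 'k. \<forall>t\<in>Poly_Mapping.keys p. \<exists>s\<in>M. mdvd s t}"
  have "ring_module.subspace ?D"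
  proof (rule ring_module.subspaceI)
    show "0 \<in> ?D" by simp
    show "p + q \<in> ?D" if "p \<in> ?D" "q \<in> ?D" for p q
      using that Poly_Mapping.keys_add[of p q] by blast
    show "r * p \<in> ?D" if "p \<in> ?D" for r p
    proof (intro CollectI ballI)
      fix t assume "t \<in> Poly_Mapping.keys (r * p)"
      then obtain a b where ab: "t = a + b" "b \<in> Poly_Mapping.keys p"
        using keys_mult[of r p] by blast
      then obtain s v where "s \<in> M" "b = s + v" using \<open>p \<in> ?D\<close> by (auto simp: mdvd_def)
      then show "\<exists>s\<in>M. mdvd s t" using ab(1) unfolding mdvd_def by (metis add.left_commute)
    qed
  qed
  moreover have "Poly_Mapping.single s 1 \<in> ?D" if "s \<in> M" for s
  proof -
    have "mdvd s s" unfolding mdvd_def by (rule exI[of _ 0]) simp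
    then show ?thesis using that by auto
  qed
  ultimately have "ideal_gen ((\<lambda>s. Poly_Mapping.single s 1) ` M) \<subseteq> ?D"
    unfolding ideal_gen_def by (intro ring_module.span_minimal) auto
  with assms show ?thesis by blast
qed

text \<open>This is how a Groebner basis enters the division algorithm.\<close>

lemma groebner_basis_divides:
  fixes p :: "'m::comm_monoid_add \<Rightarrow>\<^sub>0 'k::comm_ring_1"
  assumes "groebner_basis lt J G" "p \<in> J" "p \<noteq> 0"
  obtains g where "g \<in> G" "mdvd (in_monom lt g) (in_monom lt p)"
proof -
  have eq: "{Poly_Mapping.single (in_monom lt g) (1::'k) | g. g \<in> G}
      = (\<lambda>s. Poly_Mapping.single s 1) ` in_monom lt ` G" by blast
  have "Poly_Mapping.single (in_monom lt p) 1 \<in> in_ideal lt J"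
    unfolding in_ideal_def ideal_gen_def using assms(2,3) by (intro ring_module.span_base) blast
  then have "Poly_Mapping.single (in_monom lt p) (1::'k) \<in>
      ideal_gen ((\<lambda>s. Poly_Mapping.single s 1) ` in_monom lt ` G)"
    using assms(1) unfolding groebner_basis_def eq by simp
  from keys_monomial_ideal[OF this, of "in_monom lt p"] that show ?thesis by auto
qed

text \<open>
  The division algorithm: subtracting a suitable multiple of a member of \<open>G\<close> cancels the
  initial term of \<open>p \<in> J\<close> and leaves an element of \<open>J\<close> with a smaller initial monomial, which
  well-foundedness allows only finitely often.
\<close>

lemma groebner_basis_generates:
  fixes J :: "('m::comm_monoid_add \<Rightarrow>\<^sub>0 'k::field) set"
  assumes lt: "monomial_order lt" and wf: "wfp lt"
    and J: "ring_module.subspace J" and G: "groebner_basis lt J G"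
  shows "J \<subseteq> ideal_gen G"
proof -
  note o = monomial_orderD[OF lt]
  have "\<forall>p\<in>J. p \<noteq> 0 \<longrightarrow> in_monom lt p = t \<longrightarrow> p \<in> ideal_gen G" for t
    using wf
  proof (induction t rule: wfp_induct_rule)
    case (less t)
    show ?case
    proof (intro ballI impI)
      fix p assume p: "p \<in> J" "p \<noteq> 0" "in_monom lt p = t"
      obtain g where g: "g \<in> G" "mdvd (in_monom lt g) t"
        using groebner_basis_divides[OF G p(1,2)] p(3) by auto
      then obtain u where t: "t = u + in_monom lt g" by (auto simp: mdvd_def add.commute)
      have g0: "g \<noteq> 0" and gJ: "g \<in> J" using G g(1) by (auto simp: groebner_basis_def)
      define l where "l = Poly_Mapping.lookup g (in_monom lt g)"
      define c where "c = Poly_Mapping.lookup p t / l"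
      \<comment> \<open>\<open>p'\<close> and \<open>g'\<close> are the tails; the initial terms of \<open>p\<close> and of the subtracted multiple
        of \<open>g\<close> cancel, so only monomials below \<open>t\<close> remain.\<close>
      define g' where "g' = g - Poly_Mapping.single (in_monom lt g) l"
      define p' where "p' = p - Poly_Mapping.single t (Poly_Mapping.lookup p t)"
      define q where "q = p - Poly_Mapping.single u c * g"
      have "l \<noteq> 0" using in_monom_greatest_key(1)[OF lt g0] by (simp add: l_def in_keys_iff)
      then have "Poly_Mapping.single u c * g =
          Poly_Mapping.single t (Poly_Mapping.lookup p t) + Poly_Mapping.single u c * g'"
        by (simp add: g'_def algebra_simps mult_single t c_def)
      then have q: "q = p' - Poly_Mapping.single u c * g'" by (simp add: q_def p'_def)
      have p'_less: "lt s t" if "s \<in> Poly_Mapping.keys p'" for s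
      proof -
        have "s \<noteq> t" "s \<in> Poly_Mapping.keys p"
          using that by (auto simp: p'_def in_keys_iff lookup_minus lookup_single when_def split: if_splits)
        then show ?thesis using in_monom_greatest_key(2)[OF lt p(2)] p(3) by blast
      qed
      have g'_less: "lt s (in_monom lt g)" if "s \<in> Poly_Mapping.keys g'" for s
      proof -
        have "s \<noteq> in_monom lt g" "s \<in> Poly_Mapping.keys g"
          using that by (auto simp: g'_def l_def in_keys_iff lookup_minus lookup_single when_def split: if_splits)
        then show ?thesis using in_monom_greatest_key(2)[OF lt g0] by blast
      qed
      have q_less: "lt s t" if "s \<in> Poly_Mapping.keys q" for s
      proof -
        have "s \<in> Poly_Mapping.keys p' \<or> s \<in> Poly_Mapping.keys (Poly_Mapping.single u c * g')"
          using that unfolding q by (auto simp: in_keys_iff lookup_minus)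
        then show ?thesis
        proof
          assume "s \<in> Poly_Mapping.keys (Poly_Mapping.single u c * g')"
          then obtain b where "s = u + b" "b \<in> Poly_Mapping.keys g'"
            using keys_mult[of "Poly_Mapping.single u c" g'] by (auto split: if_splits)
          with o(5)[OF g'_less, of b u] show "lt s t" by (simp add: t add.commute)
        qed (rule p'_less)
      qed
      have "q \<in> J" unfolding q_def
        using J p(1) gJ by (intro ring_module.subspace_diff ring_module.subspace_scale)
      then have "q \<in> ideal_gen G"
      proof (cases "q = 0")
        case True
        then show ?thesis by (simp add: ideal_gen_def ring_module.span_zero)
      next
        case False
        then show ?thesis
          using less[OF q_less[OF in_monom_greatest_key(1)[OF lt False]]] \<open>q \<in> J\<close> by blast
      qed
      moreover have "Poly_Mapping.single u c * g \<in> ideal_gen G"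
        unfolding ideal_gen_def using g(1) by (intro ring_module.span_scale ring_module.span_base)
      ultimately have "q + Poly_Mapping.single u c * g \<in> ideal_gen G"
        unfolding ideal_gen_def by (rule ring_module.span_add)
      then show "p \<in> ideal_gen G" by (simp add: q_def)
    qed
  qed
  moreover have "0 \<in> ideal_gen G" by (simp add: ideal_gen_def ring_module.span_zero)
  ultimately show ?thesis by (metis subsetI)
qed

lemma keys_x_ideal:
  assumes "p \<in> x_ideal" "(u, w) \<in> Poly_Mapping.keys p"
  shows "u \<noteq> 0"
proof -
  have "p \<in> ideal_gen ((\<lambda>s. Poly_Mapping.single s 1) ` range (\<lambda>v. (Poly_Mapping.single v 1, 0)))"
    using assms(1) by (simp add: x_ideal_def image_image)
  from keys_monomial_ideal[OF this assms(2)]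
  obtain v z where "(u, w) = (Poly_Mapping.single v 1, 0) + z" by (auto simp: mdvd_def)
  then have "u = Poly_Mapping.single v 1 + fst z" by (cases z) simp
  then have "Poly_Mapping.lookup u v \<noteq> 0" by (simp add: lookup_add)
  then show ?thesis by auto
qed

section \<open>The presentation of \<open>A\<close>\<close>

context bigraded_algebra
begin

lemma evalT_superset:
  assumes "finite I" "Poly_Mapping.keys p \<subseteq> I"
  shows "evalT scale x f p =
    (\<Sum>t\<in>I. scale (Poly_Mapping.lookup p t) (monom_eval x (fst t) * monom_eval f (snd t)))"
  unfolding evalT_def using assms
  by (intro sum.mono_neutral_left) (auto simp: in_keys_iff)

lemma evalT_add: "evalT scale x f (p + q) = evalT scale x f p + evalT scale x f q"
proof -
  let ?I = "Poly_Mapping.keys p \<union> Poly_Mapping.keys q"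
  have "Poly_Mapping.keys (p + q) \<subseteq> ?I" by (rule Poly_Mapping.keys_add)
  then show ?thesis
    by (simp add: evalT_superset[of ?I] lookup_add scale_left_distrib sum.distrib)
qed

lemma evalT_zero: "evalT scale x f 0 = 0"
  by (simp add: evalT_def)

lemma evalT_diff: "evalT scale x f (p - q) = evalT scale x f p - evalT scale x f q"
  using evalT_add[of x f "p - q" q] by (simp add: algebra_simps)

lemma evalT_single:
  "evalT scale x f (Poly_Mapping.single t c) = scale c (monom_eval x (fst t) * monom_eval f (snd t))"
  by (cases "c = 0") (simp_all add: evalT_def)

lemma scale_mult_scale: "scale c a * scale e b = scale (c * e) (a * b)"
  by (simp add: scale_mult scale_mult_right mult.commute)

lemma evalT_mult: "evalT scale x f (p * q) = evalT scale x f p * evalT scale x f q"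
proof (induction p rule: polynomial_induct)
  case (single t c)
  show ?case
  proof (induction q rule: polynomial_induct)
    case (single s e)
    have "monom_eval x (fst t) * monom_eval x (fst s) * (monom_eval f (snd t) * monom_eval f (snd s))
        = monom_eval x (fst t) * monom_eval f (snd t) * (monom_eval x (fst s) * monom_eval f (snd s))"
      by (simp only: ac_simps)
    then show ?case
      by (simp only: mult_single evalT_single monom_eval_add fst_add snd_add scale_mult_scale)
  next
    case (sum q1 q2)
    then show ?case by (simp add: evalT_add distrib_left)
  qed
next
  case (sum p1 p2)
  then show ?case by (simp add: evalT_add distrib_right)
qed

lemma subspace_kernel_evalT: "ring_module.subspace (kernel (evalT scale x f))"
  by (rule ring_module.subspaceI) (simp_all add: kernel_def evalT_zero evalT_add evalT_mult)

lemma evalT_y_monomial: "evalT scale x f (Poly_Mapping.single (0, w) 1) = monom_eval f w"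
  by (simp add: evalT_single monom_eval_def)

text \<open>
  Multiplying by elements of \<open>S\<close> leaves the \<open>y\<close>-parts of the monomials alone. Hence every element
  of the \<open>S\<close>-module generated by some monomials in the \<open>f\<^sub>j\<close> has a preimage in \<open>T\<close> whose
  \<open>y\<close>-parts are among the given ones.
\<close>

lemma S_subspace_evalT:
  "module.subspace (S_action scale x) (evalT scale x f ` {q. snd ` Poly_Mapping.keys q \<subseteq> W})"
proof (rule module.subspaceI[OF module_S_action])
  let ?B = "evalT scale x f ` {q. snd ` Poly_Mapping.keys q \<subseteq> W}"
  show "0 \<in> ?B" by (rule image_eqI[of _ _ 0]) (simp_all add: evalT_zero)
  show add: "a + b \<in> ?B" if "a \<in> ?B" "b \<in> ?B" for a b
  proof -
    from that obtain q r where q: "a = evalT scale x f q" "snd ` Poly_Mapping.keys q \<subseteq> W"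
      and r: "b = evalT scale x f r" "snd ` Poly_Mapping.keys r \<subseteq> W" by blast
    have "snd ` Poly_Mapping.keys (q + r) \<subseteq> W"
      using q(2) r(2) Poly_Mapping.keys_add[of q r] by blast
    then show ?thesis
      by (intro image_eqI[of _ _ "q + r"]) (simp_all add: evalT_add q(1) r(1))
  qed
  show "S_action scale x p a \<in> ?B" if "a \<in> ?B" for p a
  proof (induction p rule: polynomial_induct)
    case (single t c)
    from that obtain q where q: "a = evalT scale x f q" "snd ` Poly_Mapping.keys q \<subseteq> W" by blast
    have "snd s \<in> W" if s: "s \<in> Poly_Mapping.keys (Poly_Mapping.single (t, 0) c * q)" for s
    proof -
      obtain a b where "s = a + b" "a \<in> Poly_Mapping.keys (Poly_Mapping.single (t, 0) c)"
          "b \<in> Poly_Mapping.keys q"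
        using s keys_mult[of "Poly_Mapping.single (t, 0) c" q] by blast
      then have "snd s = snd b" "b \<in> Poly_Mapping.keys q" by (auto split: if_splits)
      then show ?thesis using q(2) by auto
    qed
    then show ?case
      by (intro image_eqI[of _ _ "Poly_Mapping.single (t, 0) c * q"])
        (auto simp: q(1) S_action_def evalT_mult evalS_single evalT_single monom_eval_def)
  next
    case (sum p1 p2)
    then show ?case using add by (simp add: S_action_def evalS_add distrib_right)
  qed
qed

text \<open>
  A relation expressing \<open>f\<^sup>w\<close> by other monomials is an element of the kernel in which the pure
  \<open>y\<close>-monomial \<open>w\<close> has coefficient \<open>1\<close>; this is impossible when the kernel lies in
  \<open>(x\<^sub>1, \<dots>, x\<^sub>n)T\<close>.
\<close>

lemma monomial_not_in_span_of_others:
  assumes J: "kernel (evalT scale x f) \<subseteq> x_ideal"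
    and w: "monom_eval f w \<in> module.span (S_action scale x) (monom_eval f ` W)"
  shows "w \<in> W"
proof (rule ccontr)
  assume nW: "w \<notin> W"
  have "monom_eval f ` W \<subseteq> evalT scale x f ` {q. snd ` Poly_Mapping.keys q \<subseteq> W}"
  proof
    fix a assume "a \<in> monom_eval f ` W"
    then obtain v where v: "v \<in> W" "a = monom_eval f v" by blast
    then show "a \<in> evalT scale x f ` {q. snd ` Poly_Mapping.keys q \<subseteq> W}"
      by (intro image_eqI[of _ _ "Poly_Mapping.single (0, v) 1"]) (simp_all add: evalT_y_monomial)
  qed
  then have "module.span (S_action scale x) (monom_eval f ` W)
      \<subseteq> evalT scale x f ` {q. snd ` Poly_Mapping.keys q \<subseteq> W}"
    by (rule module.span_minimal[OF module_S_action _ S_subspace_evalT])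
  with w have "monom_eval f w \<in> evalT scale x f ` {q. snd ` Poly_Mapping.keys q \<subseteq> W}" ..
  then obtain q where q: "monom_eval f w = evalT scale x f q" "snd ` Poly_Mapping.keys q \<subseteq> W"
    by blast
  define p where "p = Poly_Mapping.single (0, w) 1 - q"
  have "p \<in> x_ideal"
    using J q(1) by (auto simp: p_def kernel_def evalT_diff evalT_y_monomial)
  moreover have "(0, w) \<notin> Poly_Mapping.keys q" using q(2) nW by force
  then have "(0, w) \<in> Poly_Mapping.keys p" by (simp add: p_def in_keys_iff lookup_minus)
  ultimately show False using keys_x_ideal by blast
qed

end

context standard_bigraded_algebra
begin

lemma one_component: "1 \<in> A 0 0"
  unfolding component_00 by (rule range_eqI[of _ _ 1]) simp

lemma scale_component: "a \<in> A i j \<Longrightarrow> scale c a \<in> A i j"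
  using subspace_component by (rule subspace_scale)

lemma prod_component:
  assumes "\<And>v. v \<in> V \<Longrightarrow> g v \<in> A (d v) (e v)"
  shows "(\<Prod>v\<in>V. g v) \<in> A (\<Sum>v\<in>V. d v) (\<Sum>v\<in>V. e v)"
  using assms
  by (induction V rule: infinite_finite_induct) (auto simp: one_component intro: mult_component)

lemma power_component: "a \<in> A i j \<Longrightarrow> a ^ n \<in> A (int n * i) (int n * j)"
proof (induction n)
  case (Suc n)
  then have "a * a ^ n \<in> A (i + int n * i) (j + int n * j)" by (intro mult_component)
  then show ?case by (simp add: algebra_simps)
qed (simp add: one_component)

lemma monom_eval_x_component: "monom_eval x u \<in> A (int (mdeg u)) 0"
proof -
  have "homogeneous (int (mdeg u)) (Poly_Mapping.single u (1::'k))" by (simp add: homogeneous_def)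
  then show ?thesis
    unfolding S_graded by (intro image_eqI[of _ _ "Poly_Mapping.single u 1"]) (simp_all add: evalS_single)
qed

lemma monom_eval_y_component:
  fixes f :: "'y::finite \<Rightarrow> 'a"
  assumes "\<And>j. f j \<in> A (d j) 1"
  shows "monom_eval f w \<in> A (\<Sum>j\<in>UNIV. int (Poly_Mapping.lookup w j) * d j) (int (mdeg w))"
proof -
  have "f j ^ Poly_Mapping.lookup w j
      \<in> A (int (Poly_Mapping.lookup w j) * d j) (int (Poly_Mapping.lookup w j))" for j
    using power_component[OF assms[of j], of "Poly_Mapping.lookup w j"] by simp
  then show ?thesis unfolding monom_eval_def mdeg_def of_nat_sum by (rule prod_component)
qed

text \<open>The image of \<open>\<phi>\<close> is a subring containing \<open>A\<^sub>0\<close> and \<open>A\<^sub>1\<close>.\<close>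

lemma evalT_surjective:
  assumes "module.span (S_action scale x) (range f) = y_component 1"
  shows "range (evalT scale x f) = UNIV"
proof -
  let ?B = "range (evalT scale x f)"
  have S_sub: "module.subspace (S_action scale x) ?B"
    using S_subspace_evalT[of x f UNIV] by simp
  have "f j \<in> ?B" for j
  proof (rule range_eqI)
    have "monom_eval f (Poly_Mapping.single j 1) = (\<Prod>v\<in>UNIV. if v = j then f v else 1)"
      unfolding monom_eval_def by (rule prod.cong) (auto simp: lookup_single when_def)
    then show "f j = evalT scale x f (Poly_Mapping.single (0, Poly_Mapping.single j 1) 1)"
      by (simp add: evalT_y_monomial)
  qed
  then have B1: "y_component 1 \<subseteq> ?B"
    unfolding assms[symmetric]
    by (intro module.span_minimal[OF module_S_action] S_sub) blast
  have one: "1 \<in> ?B"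
    by (rule range_eqI[of _ _ "Poly_Mapping.single (0, 0) 1"])
      (simp add: evalT_y_monomial monom_eval_def)
  have S: "evalS scale x p \<in> ?B" for p
    using module.subspace_scale[OF module_S_action S_sub one, of p] by (simp add: S_action_def)
  have "subspace ?B"
  proof (rule subspaceI)
    show "0 \<in> ?B" by (rule range_eqI[of _ _ 0]) (simp add: evalT_zero)
    show "a + b \<in> ?B" if "a \<in> ?B" "b \<in> ?B" for a b
      using module.subspace_add[OF module_S_action S_sub that] .
    show "scale c a \<in> ?B" if "a \<in> ?B" for c a
      using module.subspace_scale[OF module_S_action S_sub that, of "Poly_Mapping.single 0 c"]
      by (simp add: S_action_def evalS_single monom_eval_def scale_mult)
  qed
  then have B0: "y_component 0 \<subseteq> ?B"
    unfolding y_component_def using S by (intro span_minimal) (auto simp: S_graded)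
  have "a - b \<in> ?B \<and> a * b \<in> ?B" if "a \<in> ?B" "b \<in> ?B" for a b
  proof -
    from that obtain p q where "a = evalT scale x f p" "b = evalT scale x f q" by blast
    then have "a - b = evalT scale x f (p - q)" "a * b = evalT scale x f (p * q)"
      by (simp_all add: evalT_diff evalT_mult)
    then show ?thesis by blast
  qed
  then have "(\<lambda>B. \<forall>a\<in>B. \<forall>b\<in>B. a - b \<in> B \<and> a * b \<in> B) hull (y_component 0 \<union> y_component 1)
      \<subseteq> ?B"
    using B0 B1 by (intro hull_minimal) auto
  then show ?thesis using generated by blast
qed

text \<open>
  Because \<open>A\<close> is the direct sum of its components, a bihomogeneous element equals the part of
  any of its expressions that has the same bidegree.
\<close>

lemma component_of_sum:
  assumes "a \<in> A i j" and "finite I" and "\<And>t. t \<in> I \<Longrightarrow> g t \<in> A (fst (b t)) (snd (b t))"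
    and "a = (\<Sum>t\<in>I. g t)"
  shows "a = (\<Sum>t | t \<in> I \<and> b t = (i, j). g t)"
proof -
  \<comment> \<open>The decomposition of \<open>a\<close> as a single component, and the one that collects the \<open>g t\<close> by bidegree.\<close>
  let ?c = "Poly_Mapping.single (i, j) a" and ?e = "\<Sum>t\<in>I. Poly_Mapping.single (b t) (g t)"
  have sum_lookup: "(\<Sum>q\<in>Poly_Mapping.keys c. Poly_Mapping.lookup c q)
      = (\<Sum>q\<in>Q. Poly_Mapping.lookup c q)"
    if "finite Q" "Poly_Mapping.keys c \<subseteq> Q" for c :: "(int \<times> int) \<Rightarrow>\<^sub>0 'a" and Q
    using that by (intro sum.mono_neutral_left) (auto simp: in_keys_iff)
  have zero: "0 \<in> A k l" for k l using subspace_component by (rule subspace_0)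
  have e: "Poly_Mapping.lookup ?e q = (\<Sum>t | t \<in> I \<and> b t = q. g t)" for q
    using \<open>finite I\<close> by (simp add: lookup_sum lookup_single when_def sum.If_cases Int_def)
  have "Poly_Mapping.lookup ?c (k, l) \<in> A k l" for k l
    using assms(1) zero by (auto simp: lookup_single when_def)
  moreover have "a = (\<Sum>q\<in>Poly_Mapping.keys ?c. Poly_Mapping.lookup ?c q)"
    by (subst sum_lookup[of "{(i, j)}"]) auto
  moreover have "Poly_Mapping.lookup ?e (k, l) \<in> A k l" for k l
    unfolding e using assms(3) by (intro subspace_sum[OF subspace_component]) force
  moreover have "a = (\<Sum>q\<in>Poly_Mapping.keys ?e. Poly_Mapping.lookup ?e q)"
  proof -
    have "Poly_Mapping.keys ?e \<subseteq> b ` I"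
    proof
      fix q assume "q \<in> Poly_Mapping.keys ?e"
      then have "(\<Sum>t | t \<in> I \<and> b t = q. g t) \<noteq> 0" by (simp add: in_keys_iff e)
      then have "{t. t \<in> I \<and> b t = q} \<noteq> {}" by force
      then show "q \<in> b ` I" by blast
    qed
    then have "(\<Sum>q\<in>Poly_Mapping.keys ?e. Poly_Mapping.lookup ?e q)
        = (\<Sum>q\<in>b ` I. \<Sum>t | t \<in> I \<and> b t = q. g t)"
      using \<open>finite I\<close> by (subst sum_lookup[of "b ` I"]) (simp_all add: e)
    also have "\<dots> = (\<Sum>t\<in>I. g t)" using \<open>finite I\<close> by (rule sum.image_gen[symmetric])
    finally show ?thesis using assms(4) by simp
  qed
  ultimately have "?c = ?e" using direct_sum[of a] by blast
  then have "Poly_Mapping.lookup ?c (i, j) = Poly_Mapping.lookup ?e (i, j)" by simp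
  then show ?thesis unfolding e by simp
qed

text \<open>
  For the inclusion from right to left, an element of \<open>A\<^sub>(\<^sub>i\<^sub>,\<^sub>k\<^sub>)\<close> is written as \<open>\<phi>(p)\<close>; by
  \<open>component_of_sum\<close> only the terms of \<open>p\<close> of bidegree \<open>(i, k)\<close> matter, and their \<open>y\<close>-parts
  have degree \<open>k\<close>.
\<close>

lemma span_monomials_eq_component:
  fixes f :: "'y::finite \<Rightarrow> 'a"
  assumes f: "\<And>j. f j \<in> A (d j) 1"
    and f_span: "module.span (S_action scale x) (range f) = y_component 1"
  shows "module.span (S_action scale x) (monom_eval f ` {w. mdeg w = k}) = y_component (int k)"
    (is "?M = _")
proof
  interpret S: module "S_action scale x" by (rule module_S_action)
  have f_monomial: "monom_eval f w
      \<in> A (\<Sum>j\<in>UNIV. int (Poly_Mapping.lookup w j) * d j) (int (mdeg w))" for w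
    using f by (rule monom_eval_y_component)
  show "?M \<subseteq> y_component (int k)"
  proof (rule S.span_minimal)
    have "monom_eval f w \<in> y_component (int (mdeg w))" for w
      unfolding y_component_def
      by (rule span_base, rule UN_I, rule UNIV_I, rule f_monomial)
    then show "monom_eval f ` {w. mdeg w = k} \<subseteq> y_component (int k)" by auto
    show "S.subspace (y_component (int k))"
    proof (rule S.subspaceI)
      show "0 \<in> y_component (int k)" by (simp add: y_component_def span_zero)
      show add: "a + b \<in> y_component (int k)"
        if "a \<in> y_component (int k)" "b \<in> y_component (int k)" for a b
        using that by (simp add: y_component_def span_add)
      have x: "monom_eval x u * a \<in> y_component (int k)" if "a \<in> y_component (int k)" for u a
        using that unfolding y_component_def
      proof (induction a rule: span_induct_alt)
        case base
        show ?case by (simp add: span_zero)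
      next
        case (step c a b)
        then obtain i where "a \<in> A i (int k)" by blast
        from mult_component[OF monom_eval_x_component this, of u]
        have "monom_eval x u * a \<in> A (int (mdeg u) + i) (int k)" by simp
        then have "monom_eval x u * a \<in> span (\<Union>i. A i (int k))" by (intro span_base UN_I[OF UNIV_I])
        with step.IH show ?case
          by (simp add: distrib_left scale_mult_right span_add span_scale)
      qed
      show "S_action scale x p a \<in> y_component (int k)" if "a \<in> y_component (int k)" for p a
      proof (induction p rule: polynomial_induct)
        case (single t c)
        show ?case using x[OF that, of t]
          by (simp add: S_action_def evalS_single scale_mult y_component_def span_scale)
      next
        case (sum p1 p2)
        then show ?case by (simp add: S_action_def evalS_add distrib_right add)
      qed
    qed
  qed
  show "y_component (int k) \<subseteq> ?M"
    unfolding y_component_def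
  proof (rule span_minimal)
    show "subspace ?M"
    proof (rule subspaceI)
      show "scale c a \<in> ?M" if "a \<in> ?M" for c a
        using S.span_scale[OF that, of "Poly_Mapping.single 0 c"]
        by (simp add: S_action_def evalS_single monom_eval_def scale_mult)
    qed (simp_all add: S.span_zero S.span_add)
    show "(\<Union>i. A i (int k)) \<subseteq> ?M"
    proof
      fix a assume "a \<in> (\<Union>i. A i (int k))"
      then obtain i where a: "a \<in> A i (int k)" by blast
      obtain p where p: "a = evalT scale x f p" using evalT_surjective[OF f_span] by blast
      define g where "g t = scale (Poly_Mapping.lookup p t) (monom_eval x (fst t) * monom_eval f (snd t))" for t
      define b where "b t = (int (mdeg (fst t)) +
          (\<Sum>j\<in>UNIV. int (Poly_Mapping.lookup (snd t) j) * d j), int (mdeg (snd t)))"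
        for t :: "'x monom \<times> 'y monom"
      have "g t \<in> A (fst (b t)) (snd (b t))" for t
        using mult_component[OF monom_eval_x_component[of "fst t"] f_monomial[of "snd t"]]
        by (simp add: g_def b_def scale_component)
      then have "a = (\<Sum>t | t \<in> Poly_Mapping.keys p \<and> b t = (i, int k). g t)"
        using a p by (intro component_of_sum) (simp_all add: evalT_def g_def)
      moreover have "g t \<in> ?M" if "b t = (i, int k)" for t
      proof -
        have "monom_eval f (snd t) \<in> ?M" using that by (intro S.span_base) (simp add: b_def)
        from S.span_scale[OF this, of "Poly_Mapping.single (fst t) (Poly_Mapping.lookup p t)"]
        show ?thesis by (simp add: g_def S_action_def evalS_single scale_mult)
      qed
      ultimately show "a \<in> ?M" using S.span_sum[of "{t \<in> Poly_Mapping.keys p. b t = (i, int k)}" g]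
        by simp
    qed
  qed
qed

end

section \<open>Minimal generators of \<open>A\<^sub>k\<close>\<close>

theorem proposition2p5:
  fixes scale :: "'k::field \<Rightarrow> 'a::comm_ring_1 \<Rightarrow> 'a"
    and A :: "int \<Rightarrow> int \<Rightarrow> 'a set"
    and x :: "'x::finite \<Rightarrow> 'a"
    and f :: "'y::finite \<Rightarrow> 'a" and d :: "'y \<Rightarrow> int"
    and ltx :: "'x monom \<Rightarrow> 'x monom \<Rightarrow> bool"
    and lty :: "'y monom \<Rightarrow> 'y monom \<Rightarrow> bool"
    and J G :: "('x, 'y, 'k) polyT set"
    and k :: nat and hs :: "'y monom list"
  assumes "standard_bigraded_algebra scale A x"
    and "\<And>j. f j \<in> A (d j) 1"
    and "module.span (S_action scale x) (range f) = bigraded_algebra.y_component scale A 1"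
    and "J = kernel (evalT scale x f)"
    and "monomial_order lty" and "monomial_order ltx"
    and "x_condition (product_order lty ltx) J"
    and "k \<ge> 1"
    and "sorted_wrt lty hs"
    and "set hs = {w. mdeg w = k \<and>
           Poly_Mapping.single (0, w) 1 \<notin> in_ideal (product_order lty ltx) J}"
    and "reduced_groebner_basis (product_order lty ltx) J G"
    and "G \<subseteq> x_ideal"
  shows "distinct (map (\<lambda>w. evalT scale x f (Poly_Mapping.single (0, w) 1)) hs) \<and>
    minimal_generating_set (S_action scale x)
      (set (map (\<lambda>w. evalT scale x f (Poly_Mapping.single (0, w) 1)) hs))
      (bigraded_algebra.y_component scale A (int k))"
proof -
  interpret standard_bigraded_algebra scale A x by fact
  let ?lt = "product_order lty ltx" and ?h = "monom_eval f"
  have lt: "monomial_order ?lt"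
    using assms(5,6) by (rule monomial_order_product_order)
  have wf: "wfp ?lt"
    using assms(5,6) by (intro wfp_product_order wfp_monomial_order)
  have G: "groebner_basis ?lt J G" using assms(11) by (simp add: reduced_groebner_basis_def)
  have "ring_module.subspace J" unfolding assms(4) by (rule subspace_kernel_evalT)
  from groebner_basis_generates[OF lt wf this G]
  have "J \<subseteq> ideal_gen G" .
  also have "\<dots> \<subseteq> x_ideal"
    using assms(12) unfolding ideal_gen_def x_ideal_def
    by (rule ring_module.span_minimal) (rule ring_module.subspace_span)
  finally have J: "kernel (evalT scale x f) \<subseteq> x_ideal" unfolding assms(4) .
  \<comment> \<open>Every initial monomial of \<open>J\<close> involves some \<open>x\<^sub>i\<close>, so \<open>in(J)\<close> contains no monomial in the \<open>y\<^sub>j\<close> alone.\<close>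
  have "Poly_Mapping.single (0, w) 1 \<notin> in_ideal ?lt J" for w
  proof
    assume "Poly_Mapping.single (0, w) 1 \<in> in_ideal ?lt J"
    then have "Poly_Mapping.single (0, w) (1::'k)
        \<in> ideal_gen ((\<lambda>s. Poly_Mapping.single s 1) ` in_monom ?lt ` (J - {0}))"
      unfolding in_ideal_def by (rule back_subst[of "\<lambda>M. _ \<in> ideal_gen M"]) blast
    from keys_monomial_ideal[OF this, of "(0, w)"]
    obtain p where p: "p \<in> J" "p \<noteq> 0" "mdvd (in_monom ?lt p) (0, w)" by auto
    obtain u v where uv: "in_monom ?lt p = (u, v)" by (cases "in_monom ?lt p")
    have "u \<noteq> 0"
      using in_monom_greatest_key(1)[OF lt p(2)] p(1) J assms(4) uv by (auto dest: keys_x_ideal)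
    moreover have "mdvd u 0" using p(3) uv by (auto simp: mdvd_def)
    then have "u = 0" by (intro poly_mapping_eqI) (simp add: mdvd_iff_lookup_le)
    ultimately show False by blast
  qed
  then have hs: "set hs = {w. mdeg w = k}" using assms(10) by simp
  have independent: "w \<in> W" if "?h w \<in> module.span (S_action scale x) (?h ` W)" for w W
    using J that by (rule monomial_not_in_span_of_others)
  have inj: "inj ?h"
  proof (rule injI)
    fix v w assume "?h v = ?h w"
    then have "?h v \<in> module.span (S_action scale x) (?h ` {w})"
      by (simp add: module.span_base[OF module_S_action])
    from independent[OF this] show "v = w" by simp
  qed
  have "distinct hs"
    using assms(9) monomial_orderD(1)[OF assms(5)] by (induction hs) auto
  with inj have "distinct (map ?h hs)" by (simp add: distinct_map inj_on_def)
  moreover have "module.span (S_action scale x) (?h ` set hs) = y_component (int k)"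
    unfolding hs using assms(2,3) by (rule span_monomials_eq_component)
  moreover have "module.span (S_action scale x) H \<noteq> y_component (int k)"
    if H: "H \<subset> ?h ` set hs" for H
  proof
    assume "module.span (S_action scale x) H = y_component (int k)"
    moreover obtain W where W: "W \<subseteq> set hs" "H = ?h ` W"
      using H by (metis psubset_imp_subset subset_imageE)
    moreover obtain w where w: "w \<in> set hs" "w \<notin> W" using H W by blast
    moreover have "?h w \<in> module.span (S_action scale x) (?h ` set hs)"
      using w(1) by (simp add: module.span_base[OF module_S_action])
    ultimately have "?h w \<in> module.span (S_action scale x) (?h ` W)"
      using \<open>module.span (S_action scale x) (?h ` set hs) = y_component (int k)\<close> by simp
    with independent w(2) show False by blast
  qed
  ultimately show ?thesis
    by (simp add: minimal_generating_set_def evalT_y_monomial)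
qed

end
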